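(* Let $h_\theta:\mathcal X\to\mathbb R^V$ be a network with parameters $\theta\in\mathbb R^d$, let $\mathbf z=h_\theta(x)$ be its logits, and let $\mathbf p_\theta(x)=\mathrm{Softmax}(h_\theta(x))\in\mathbb R^V$ be its predicted distribution. Let $\theta^{t+1}$ be obtained from $\theta^t$ by one stochastic gradient descent step with learning rate $\eta>0$ on a single updating example $(x_u,y_u)$ with loss $\mathcal L$: $$\theta^{t+1}-\theta^t=-\eta\,\nabla_\theta\mathcal L(\mathbf p_{\theta}(x_u),y_u)\big|_{\theta^t}.$$ Assume that the function is differentiable around $\theta$, so that the first-order Taylor expansion $$\log\mathbf p_{\theta^{t+1}}(x_o)=\log\mathbf p_{\theta^t}(x_o)+\big\langle\nabla_\theta\log\mathbf p_{\theta^t}(x_o),\ \theta^{t+1}-\theta^t\big\rangle+O(\|\theta^{t+1}-\theta^t\|^2)$$ exists, and that the network's gradient is bounded, so that the higher-order terms remain controlled. Then, for an observing example $x_o$, the change of the log-probability vector $$\Delta^t(x_o)=\log\mathbf p_{\theta^{t+1}}(x_o)-\log\mathbf p_{\theta^t}(x_o)\in\mathbb R^V$$ (logarithm taken entrywise) satisfies $$\Delta^t(x_o)=-\eta\,\mathcal A^t(x_o)\,\mathcal K^t(x_o,x_u)\,\mathcal G^t(x_u,y_u)+O\big(\|\theta^{t+1}-\theta^t\|^2\big),$$ where $$O\big(\|\theta^{t+1}-\theta^t\|^2\big)=O\big(\eta^2\,\|\nabla_\theta\mathbf z^t(x_u)\|_{\mathrm{op}}^2\,\|\mathcal G^t(x_u,y_u)\|^2\big),$$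 which is typically $O(\eta^2)$ (the gap term $\mathcal G^t$ being bounded and the gradient of $\mathbf z$ with respect to $\theta$ being bounded) and can be neglected when $\eta$ is small.
   Context: Notation. $\mathrm{Softmax}_i(\mathbf z)=e^{z_i}/\sum_{j=1}^V e^{z_j}$. Write $\mathbf z^t(x)=h_{\theta^t}(x)$, and let $\nabla_\theta\mathbf z^t(x)|_{\theta^t}\in\mathbb R^{V\times d}$ be the Jacobian of $\theta\mapsto h_\theta(x)$ at $\theta^t$; $\|\cdot\|_{\mathrm{op}}$ is the operator norm. The inner product in the Taylor expansion denotes the product of the $V\times d$ Jacobian of $\theta\mapsto\log\mathbf p_\theta(x_o)$ at $\theta^t$ with the $d\times1$ vector $\theta^{t+1}-\theta^t$. The three factors are: - $\mathcal A^t(x_o)=\nabla_{\mathbf z}\log\mathbf p^t(x_o)|_{\mathbf z^t}=I-\mathbf 1\,\mathbf p_{\theta^t}(x_o)^\top\in\mathbb R^{V\times V}$, the Jacobian of the log-softmax at $\mathbf z^t(x_o)$, with $\mathbf 1$ the all-ones column vector. - $\mathcal K^t(x_o,x_u)=\big(\nabla_\theta\mathbf z^t(x_o)|_{\theta^t}\big)\big(\nabla_\theta\mathbf z^t(x_u)|_{\theta^t}\big)^\top\in\mathbb R^{V\times V}$, the empirical neural tangent kernel of $h_\theta$. - $\mathcal G^t(x_u,y_u)=\big(\nabla_{\mathbf z}\mathcal L(x_u,y_u)|_{\mathbf z^t}\big)^\top\in\mathbb R^{V\times1}$, the gradient of the loss with respect to the logits at $\mathbf z^t(x_u)$, as a column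 vector. For the cross-entropy loss $\mathcal L=-\mathbf e_{y_u}^\top\log\mathbf p(x_u)$, with $\mathbf e_{y_u}$ the one-hot vector of the label, it equals $\mathbf p_{\theta^t}(x_u)-\mathbf e_{y_u}$. The regularity conditions are stated informally in the source ("mild assumptions"): differentiability around $\theta$ so that the displayed expansion exists, and a bounded network gradient. *)

theory Defs
  imports "HOL-Analysis.Analysis" "HOL-Library.Landau_Symbols"
begin

definition softmax :: "real^'v \<Rightarrow> real^'v" where
  "softmax z = (\<chi> i. exp (z $ i) / (\<Sum>j\<in>UNIV. exp (z $ j)))"

definition vec_ln :: "real^'v \<Rightarrow> real^'v" where
  "vec_ln p = (\<chi> i. ln (p $ i))"

definition gradient :: "('a::euclidean_space \<Rightarrow> real) \<Rightarrow> 'a \<Rightarrow> 'a" where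
  "gradient f a = (THE D. GDERIV f a :> D)"

text \<open>A network is a function \<open>h\<close> of the parameter \<open>\<theta>\<close> and the input \<open>x\<close>. A loss takes a
  probability vector and a label; labels have an arbitrary type, so soft targets are allowed.\<close>

definition pred :: "(real^'d \<Rightarrow> 'x \<Rightarrow> real^'v) \<Rightarrow> real^'d \<Rightarrow> 'x \<Rightarrow> real^'v" where
  "pred h \<theta> x = softmax (h \<theta> x)"

definition log_pred :: "(real^'d \<Rightarrow> 'x \<Rightarrow> real^'v) \<Rightarrow> real^'d \<Rightarrow> 'x \<Rightarrow> real^'v" where
  "log_pred h \<theta> x = vec_ln (pred h \<theta> x)"

definition logit_jacobian :: "(real^'d \<Rightarrow> 'x \<Rightarrow> real^'v) \<Rightarrow> real^'d \<Rightarrow> 'x \<Rightarrow> real^'d^'v" where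
  "logit_jacobian h \<theta> x = jacobian (\<lambda>\<theta>'. h \<theta>' x) (at \<theta>)"

definition log_pred_jacobian :: "(real^'d \<Rightarrow> 'x \<Rightarrow> real^'v) \<Rightarrow> real^'d \<Rightarrow> 'x \<Rightarrow> real^'d^'v" where
  "log_pred_jacobian h \<theta> x = jacobian (\<lambda>\<theta>'. log_pred h \<theta>' x) (at \<theta>)"

definition op_norm :: "real^'n^'m \<Rightarrow> real" where
  "op_norm J = onorm (\<lambda>v. J *v v)"

text \<open>The three factors \<open>\<A>\<close>, \<open>\<K>\<close> and \<open>\<G>\<close> of the decomposition.\<close>

definition A_mat :: "(real^'d \<Rightarrow> 'x \<Rightarrow> real^'v) \<Rightarrow> real^'d \<Rightarrow> 'x \<Rightarrow> real^'v^'v" where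
  "A_mat h \<theta> x = jacobian (\<lambda>z. vec_ln (softmax z)) (at (h \<theta> x))"

definition K_mat :: "(real^'d \<Rightarrow> 'x \<Rightarrow> real^'v) \<Rightarrow> real^'d \<Rightarrow> 'x \<Rightarrow> 'x \<Rightarrow> real^'v^'v" where
  "K_mat h \<theta> x x' = logit_jacobian h \<theta> x ** transpose (logit_jacobian h \<theta> x')"

definition G_vec ::
  "(real^'v \<Rightarrow> 'y \<Rightarrow> real) \<Rightarrow> (real^'d \<Rightarrow> 'x \<Rightarrow> real^'v) \<Rightarrow> real^'d \<Rightarrow> 'x \<Rightarrow> 'y \<Rightarrow> real^'v" where
  "G_vec L h \<theta> x y = gradient (\<lambda>z. L (softmax z) y) (h \<theta> x)"

definition cross_entropy :: "real^'v \<Rightarrow> 'v \<Rightarrow> real" where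
  "cross_entropy p y = - (axis y 1 \<bullet> vec_ln p)"

definition sgd_step ::
  "(real^'v \<Rightarrow> 'y \<Rightarrow> real) \<Rightarrow> (real^'d \<Rightarrow> 'x \<Rightarrow> real^'v) \<Rightarrow> real \<Rightarrow> 'x \<Rightarrow> 'y \<Rightarrow> real^'d \<Rightarrow> real^'d \<Rightarrow> bool"
where
  "sgd_step L h \<eta> x y \<theta> \<theta>' \<longleftrightarrow>
     \<theta>' - \<theta> = - (\<eta> *\<^sub>R gradient (\<lambda>\<phi>. L (pred h \<phi> x) y) \<theta>)"

text \<open>The error of \<open>\<Delta> = - \<eta> \<A> \<K> \<G>\<close> when the parameter moves from \<open>\<theta>\<close> to \<open>\<theta>'\<close>.\<close>

definition step_error ::
  "(real^'v \<Rightarrow> 'y \<Rightarrow> real) \<Rightarrow> (real^'d \<Rightarrow> 'x \<Rightarrow> real^'v) \<Rightarrow> real \<Rightarrow> 'x \<Rightarrow> 'x \<Rightarrow> 'y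
     \<Rightarrow> real^'d \<Rightarrow> real^'d \<Rightarrow> real^'v"
where
  "step_error L h \<eta> xo xu yu \<theta> \<theta>' =
     (log_pred h \<theta>' xo - log_pred h \<theta> xo)
     - (- (\<eta> *\<^sub>R ((A_mat h \<theta> xo ** K_mat h \<theta> xo xu) *v G_vec L h \<theta> xu yu)))"

end

theory Submission
  imports Defs
begin

text \<open>By the chain rule the gradient of the loss in the parameters is \<open>J\<^sub>u\<^sup>T \<G>\<close> and the Jacobian of
  the log-probabilities is \<open>\<A> J\<^sub>o\<close>. Hence for an SGD step \<open>- \<eta> \<A> \<K> \<G>\<close> is exactly the linear Taylor
  term, so that the error is the Taylor remainder, and the length of the step is
  \<open>\<eta> \<parallel>J\<^sub>u\<^sup>T \<G>\<parallel> \<le> \<eta> \<parallel>J\<^sub>u\<parallel> \<parallel>\<G>\<parallel>\<close>.\<close>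

text \<open>\<open>gradient\<close> is a definite description, so exhibiting one representing vector
  fixes its value only once uniqueness is known. Uniqueness of the derivative provides it, because a
  vector is determined by its inner products.\<close>

lemma gradient_eq:
  assumes "GDERIV f a :> D"
  shows "gradient f a = D"
proof -
  have "D' = D" if "GDERIV f a :> D'" for D'
  proof -
    have "(\<lambda>h. h \<bullet> D') = (\<lambda>h. h \<bullet> D)"
      using that assms unfolding gderiv_def by (rule has_derivative_unique)
    then have "\<forall>h. h \<bullet> D' = h \<bullet> D" by (intro allI) (rule fun_cong)
    then show ?thesis by (simp only: vector_eq_ldot)
  qed
  with assms show ?thesis unfolding gradient_def by (rule the_equality)
qed

text \<open>Riesz representation in finite dimension: a linear functional \<open>f'\<close>
  satisfies \<open>f' v = f' v * 1\<close>, so moving \<open>f'\<close> to the other side of this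
  inner product on the reals shows that \<open>adjoint f' 1\<close> represents it.\<close>

lemma gradient_works:
  fixes f :: "'a::euclidean_space \<Rightarrow> real"
  assumes "f differentiable (at a)"
  shows "GDERIV f a :> gradient f a"
proof -
  obtain f' where f': "(f has_derivative f') (at a)"
    using assms unfolding differentiable_def by blast
  interpret bounded_linear f' using f' by (rule has_derivative_bounded_linear)
  have "f' v = v \<bullet> adjoint f' 1" for v
    using adjoint_works[OF linear_axioms, of v 1] by simp
  then have "f' = (\<lambda>v. v \<bullet> adjoint f' 1)" by (rule ext)
  with f' have "GDERIV f a :> adjoint f' 1"
    unfolding gderiv_def by (rule back_subst)
  then show ?thesis using gradient_eq[of f a] by simp
qed

lemma jacobian_eq:
  fixes J :: "real^'n^'m"
  assumes "(f has_derivative (\<lambda>v. J *v v)) (at a)"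
  shows "jacobian f (at a) = J"
  unfolding jacobian_def frechet_derivative_at[OF assms, symmetric]
  by simp

lemma inner_transpose_mult: "w \<bullet> (transpose J *v v) = (J *v w) \<bullet> v" for J :: "real^'n^'m"
  using adjoint_works[OF matrix_vector_mul_linear, of w J v] by (simp only: adjoint_matrix)

text \<open>With \<open>w = transpose J *v v\<close>, the square of \<open>norm w\<close> is
  \<open>v \<bullet> (J *v w)\<close>; Cauchy-Schwarz bounds it by
  \<open>norm v * op_norm J * norm w\<close>. One factor \<open>norm w\<close> is then cancelled,
  hence the case split on \<open>w = 0\<close>.\<close>

lemma norm_transpose_mult_le: "norm (transpose J *v v) \<le> op_norm J * norm v"
proof (cases "transpose J *v v = 0")
  case True
  then show ?thesis
    unfolding op_norm_def by (simp add: onorm_pos_le matrix_vector_mul_bounded_linear)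
next
  case False
  let ?w = "transpose J *v v"
  have "norm ?w * norm ?w = v \<bullet> (J *v ?w)"
    unfolding power2_eq_square[symmetric] power2_norm_eq_inner inner_transpose_mult
    by (rule inner_commute)
  also have "\<dots> \<le> norm v * norm (J *v ?w)" by (rule norm_cauchy_schwarz)
  also have "\<dots> \<le> norm v * (op_norm J * norm ?w)"
    unfolding op_norm_def
    by (intro mult_left_mono onorm matrix_vector_mul_bounded_linear) simp
  finally show ?thesis using False by (simp add: mult_ac)
qed

lemma sum_exp_pos: "0 < (\<Sum>j\<in>UNIV. exp ((z :: real^'v) $ j))"
  by (intro sum_pos) auto

text \<open>In this form only the log-sum-exp term is nonlinear, and its gradient is the softmax
  itself. This is where the rank-one part of \<open>A_mat\<close> comes from.\<close>

lemma vec_ln_softmax_nth: "vec_ln (softmax z) $ i = z $ i - ln (\<Sum>j\<in>UNIV. exp (z $ j))"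
  using sum_exp_pos[of z] by (simp add: vec_ln_def softmax_def ln_div)

lemma has_derivative_log_softmax_nth:
  "((\<lambda>z. vec_ln (softmax z) $ i) has_derivative (\<lambda>v. v $ i - softmax z \<bullet> v)) (at z)"
proof -
  have "((\<lambda>z. z $ i - ln (\<Sum>j\<in>UNIV. exp (z $ j))) has_derivative
      (\<lambda>v. v $ i - softmax z \<bullet> v)) (at z)"
    using sum_exp_pos[of z]
    by (auto intro!: derivative_eq_intros bounded_linear.has_derivative[OF bounded_linear_vec_nth]
        simp: softmax_def inner_vec_def sum_divide_distrib sum_distrib_left sum_distrib_right field_simps)
  then show ?thesis unfolding vec_ln_softmax_nth .
qed

lemma has_derivative_log_softmax:
  "((\<lambda>z. vec_ln (softmax z)) has_derivative
     (\<lambda>v. (mat 1 - (\<chi> i j. softmax z $ j)) *v v)) (at z)"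
proof -
  have "((mat 1 - (\<chi> i j. softmax z $ j)) *v v) $ i = v $ i - softmax z \<bullet> v" for v i
    by (simp add: matrix_vector_mult_diff_rdistrib)
      (simp add: matrix_vector_mult_def inner_vec_def)
  \<comment> \<open>A vector-valued derivative may be checked against the basis vectors
    \<open>axis i 1\<close>, that is, coordinate by coordinate.\<close>
  then show ?thesis
    by (subst has_derivative_componentwise_within)
      (auto simp: Basis_vec_def inner_axis has_derivative_log_softmax_nth)
qed

lemma A_mat_eq: "A_mat h \<theta> x = mat 1 - (\<chi> i j. pred h \<theta> x $ j)"
  unfolding A_mat_def pred_def by (rule jacobian_eq[OF has_derivative_log_softmax])

text \<open>After the softmax, cross-entropy is minus coordinate \<open>y\<close> of the
  log-softmax, so its gradient is the negated row \<open>y\<close> of \<open>A_mat\<close>.\<close>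

lemma G_vec_cross_entropy: "G_vec cross_entropy h \<theta> x y = pred h \<theta> x - axis y 1"
  unfolding G_vec_def
proof (rule gradient_eq)
  have "((\<lambda>z. - (vec_ln (softmax z) $ y)) has_derivative
      (\<lambda>v. - (v $ y - softmax (h \<theta> x) \<bullet> v))) (at (h \<theta> x))"
    by (intro has_derivative_minus has_derivative_log_softmax_nth)
  then show "GDERIV (\<lambda>z. cross_entropy (softmax z) y) (h \<theta> x) :> pred h \<theta> x - axis y 1"
    by (simp add: gderiv_def cross_entropy_def pred_def inner_axis inner_axis' inner_diff_right
        inner_commute)
qed

lemma has_derivative_logits:
  assumes "(\<lambda>\<phi>. h \<phi> x) differentiable (at \<theta>)"
  shows "((\<lambda>\<phi>. h \<phi> x) has_derivative (\<lambda>v. logit_jacobian h \<theta> x *v v)) (at \<theta>)"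
  using assms unfolding logit_jacobian_def jacobian_works .

lemma log_pred_jacobian_eq:
  assumes "(\<lambda>\<phi>. h \<phi> x) differentiable (at \<theta>)"
  shows "log_pred_jacobian h \<theta> x = A_mat h \<theta> x ** logit_jacobian h \<theta> x"
  unfolding log_pred_jacobian_def log_pred_def pred_def A_mat_eq
  using has_derivative_compose[OF has_derivative_logits[of h x, OF assms] has_derivative_log_softmax]
  by (intro jacobian_eq) (simp add: matrix_vector_mul_assoc)

text \<open>The chain rule yields the functional that sends \<open>v\<close> to the inner product of
  \<open>J *v v\<close> with the logit gradient. Moving \<open>J\<close> across the inner product
  produces the transpose, the right-hand factor of the tangent kernel.\<close>

lemma loss_gradient_eq:
  assumes "(\<lambda>\<phi>. h \<phi> x) differentiable (at \<theta>)"
    and "(\<lambda>z. L (softmax z) y) differentiable (at (h \<theta> x))"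
  shows "gradient (\<lambda>\<phi>. L (pred h \<phi> x) y) \<theta> = transpose (logit_jacobian h \<theta> x) *v G_vec L h \<theta> x y"
proof (rule gradient_eq)
  have "((\<lambda>\<phi>. L (softmax (h \<phi> x)) y) has_derivative
      (\<lambda>v. (logit_jacobian h \<theta> x *v v) \<bullet> G_vec L h \<theta> x y)) (at \<theta>)"
    using has_derivative_compose[OF has_derivative_logits[of h x, OF assms(1)]
        gradient_works[OF assms(2), unfolded gderiv_def]]
    by (simp add: G_vec_def)
  then show "GDERIV (\<lambda>\<phi>. L (pred h \<phi> x) y) \<theta> :>
      transpose (logit_jacobian h \<theta> x) *v G_vec L h \<theta> x y"
    by (simp only: gderiv_def pred_def inner_transpose_mult)
qed

text \<open>The right-hand side involves the updating example only through \<theta>', so a single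
  Taylor bound at \<open>xo\<close> will serve for all updating examples.\<close>

lemma step_error_eq_taylor_remainder:
  assumes "(\<lambda>\<phi>. h \<phi> xo) differentiable (at \<theta>)"
    and "(\<lambda>\<phi>. h \<phi> xu) differentiable (at \<theta>)"
    and "(\<lambda>z. L (softmax z) yu) differentiable (at (h \<theta> xu))"
    and "sgd_step L h \<eta> xu yu \<theta> \<theta>'"
  shows "step_error L h \<eta> xo xu yu \<theta> \<theta>' =
    log_pred h \<theta>' xo - (log_pred h \<theta> xo + log_pred_jacobian h \<theta> xo *v (\<theta>' - \<theta>))"
proof -
  have "\<theta>' - \<theta> = - (\<eta> *\<^sub>R (transpose (logit_jacobian h \<theta> xu) *v G_vec L h \<theta> xu yu))"
    using assms(4) unfolding sgd_step_def loss_gradient_eq[of h xu \<theta> L yu, OF assms(2,3)] .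
  \<comment> \<open>Substituting the step gives the product of \<open>A_mat\<close>, the Jacobian at
    \<open>xo\<close>, the transposed Jacobian at \<open>xu\<close> and \<open>G_vec\<close>;
    associativity groups the two middle factors into \<open>K_mat\<close>.\<close>
  then have "log_pred_jacobian h \<theta> xo *v (\<theta>' - \<theta>) =
      - (\<eta> *\<^sub>R ((A_mat h \<theta> xo ** K_mat h \<theta> xo xu) *v G_vec L h \<theta> xu yu))"
    by (simp add: log_pred_jacobian_eq[of h, OF assms(1)] K_mat_def matrix_vector_mul_assoc
        matrix_mul_assoc vec.neg matrix_vector_mult_scaleR del: transpose_matrix_vector)
  then show ?thesis by (simp add: step_error_def)
qed

lemma norm_sgd_step_le:
  assumes "(\<lambda>\<phi>. h \<phi> x) differentiable (at \<theta>)"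
    and "(\<lambda>z. L (softmax z) y) differentiable (at (h \<theta> x))"
    and "sgd_step L h \<eta> x y \<theta> \<theta>'" and "0 < \<eta>"
  shows "norm (\<theta>' - \<theta>) \<le> \<eta> * (op_norm (logit_jacobian h \<theta> x) * norm (G_vec L h \<theta> x y))"
  using assms(3,4) norm_transpose_mult_le[of "logit_jacobian h \<theta> x" "G_vec L h \<theta> x y"]
  by (simp add: sgd_step_def loss_gradient_eq[of h x \<theta> L y, OF assms(1,2)])

text \<open>The Landau symbols are unfolded into explicit constants to make uniformity visible:
  \<open>C\<close> and \<open>r\<close> are chosen before the updating example in \<open>S\<close>
  and the learning rate, and \<delta> depends on the example only through the common bounds
  \<open>M\<close> and \<open>B\<close>. The last clause is the typical quadratic order in
  \<eta>.\<close>

theorem mainTheorem1: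
  fixes h :: "real^'d \<Rightarrow> 'x \<Rightarrow> real^'v"
    and L :: "real^'v \<Rightarrow> 'y \<Rightarrow> real"
    and \<theta> :: "real^'d"
    and xo :: 'x
    and S :: "('x \<times> 'y) set"
    and M :: real
  assumes differentiable_around:
      "\<And>x. x \<in> insert xo (fst ` S) \<Longrightarrow>
         \<forall>\<^sub>F \<theta>' in nhds \<theta>. (\<lambda>\<phi>. h \<phi> x) differentiable (at \<theta>')"
    and bounded_gradient:
      "\<And>x. x \<in> insert xo (fst ` S) \<Longrightarrow>
         \<forall>\<^sub>F \<theta>' in nhds \<theta>. op_norm (logit_jacobian h \<theta>' x) \<le> M"
    and loss_differentiable:
      "\<And>x y. (x, y) \<in> S \<Longrightarrow> (\<lambda>z. L (softmax z) y) differentiable (at (h \<theta> x))"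
    and taylor_expansion:
      "(\<lambda>\<theta>'. norm (log_pred h \<theta>' xo
                 - (log_pred h \<theta> xo + log_pred_jacobian h \<theta> xo *v (\<theta>' - \<theta>))))
         \<in> O[nhds \<theta>](\<lambda>\<theta>'. (norm (\<theta>' - \<theta>))\<^sup>2)"
  shows
    "A_mat h \<theta> xo = mat 1 - (\<chi> i j. pred h \<theta> xo $ j)
     \<and> (\<forall>x (y :: 'v). G_vec cross_entropy h \<theta> x y = pred h \<theta> x - axis y 1)
     \<and> (\<exists>C \<ge> 0.
          (\<exists>r > 0. \<forall>(xu, yu) \<in> S. \<forall>\<eta> > 0. \<forall>\<theta>'.
             sgd_step L h \<eta> xu yu \<theta> \<theta>' \<and> norm (\<theta>' - \<theta>) < r \<longrightarrow>
               norm (step_error L h \<eta> xo xu yu \<theta> \<theta>') \<le> C * (norm (\<theta>' - \<theta>))\<^sup>2)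
        \<and> (\<forall>(xu, yu) \<in> S. \<forall>\<eta> > 0. \<forall>\<theta>'.
             sgd_step L h \<eta> xu yu \<theta> \<theta>' \<longrightarrow>
               (norm (\<theta>' - \<theta>))\<^sup>2
                 \<le> \<eta>\<^sup>2 * (op_norm (logit_jacobian h \<theta> xu))\<^sup>2 * (norm (G_vec L h \<theta> xu yu))\<^sup>2)
        \<and> (\<forall>B. \<exists>\<delta> > 0. \<forall>(xu, yu) \<in> S. \<forall>\<eta> > 0. \<forall>\<theta>'.
             sgd_step L h \<eta> xu yu \<theta> \<theta>' \<and> \<eta> < \<delta> \<and> norm (G_vec L h \<theta> xu yu) \<le> B \<longrightarrow>
               norm (step_error L h \<eta> xo xu yu \<theta> \<theta>') \<le> C * M\<^sup>2 * B\<^sup>2 * \<eta>\<^sup>2))"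
proof -
  \<comment> \<open>The filter \<open>nhds \<theta>\<close> contains the centre, so what holds
    eventually holds at \<theta> itself; the Jacobian bound is specialised in the same way.\<close>
  have diff: "(\<lambda>\<phi>. h \<phi> x) differentiable (at \<theta>)" if "x \<in> insert xo (fst ` S)" for x
    using differentiable_around[OF that] by (rule eventually_nhds_x_imp_x)
  have diff_o: "(\<lambda>\<phi>. h \<phi> xo) differentiable (at \<theta>)"
    by (simp add: diff)
  have diff_u: "(\<lambda>\<phi>. h \<phi> x) differentiable (at \<theta>)" if "(x, y) \<in> S" for x y
    using that by (intro diff) force
  have jac_le: "op_norm (logit_jacobian h \<theta> x) \<le> M" if "(x, y) \<in> S" for x y
    using that by (intro eventually_nhds_x_imp_x[OF bounded_gradient]) force
  note step_le = norm_sgd_step_le[of h _ \<theta> L, OF diff_u loss_differentiable]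
  obtain C where "0 < C" and "\<forall>\<^sub>F \<theta>' in nhds \<theta>.
      norm (log_pred h \<theta>' xo - (log_pred h \<theta> xo + log_pred_jacobian h \<theta> xo *v (\<theta>' - \<theta>)))
        \<le> C * (norm (\<theta>' - \<theta>))\<^sup>2"
    by (rule landau_o.bigE[OF taylor_expansion]) auto
  then obtain r where "0 < r" and "\<And>\<theta>'. norm (\<theta>' - \<theta>) < r \<Longrightarrow>
      norm (log_pred h \<theta>' xo - (log_pred h \<theta> xo + log_pred_jacobian h \<theta> xo *v (\<theta>' - \<theta>)))
        \<le> C * (norm (\<theta>' - \<theta>))\<^sup>2"
    unfolding eventually_nhds_metric dist_norm by blast
  then have err: "norm (step_error L h \<eta> xo x y \<theta> \<theta>') \<le> C * (norm (\<theta>' - \<theta>))\<^sup>2"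
    if "(x, y) \<in> S" "sgd_step L h \<eta> x y \<theta> \<theta>'" "norm (\<theta>' - \<theta>) < r" for x y \<eta> \<theta>'
    using that step_error_eq_taylor_remainder[of h xo \<theta> x L y, OF diff_o diff_u loss_differentiable]
    by simp
  have step_sq: "(norm (\<theta>' - \<theta>))\<^sup>2
      \<le> \<eta>\<^sup>2 * (op_norm (logit_jacobian h \<theta> x))\<^sup>2 * (norm (G_vec L h \<theta> x y))\<^sup>2"
    if "(x, y) \<in> S" "0 < \<eta>" "sgd_step L h \<eta> x y \<theta> \<theta>'" for x y \<eta> \<theta>'
    using power_mono[OF step_le[OF that(1,1,3,2)], of 2] by (simp add: power_mult_distrib mult_ac)
  have small: "\<exists>\<delta> > 0. \<forall>(x, y) \<in> S. \<forall>\<eta> > 0. \<forall>\<theta>'.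
      sgd_step L h \<eta> x y \<theta> \<theta>' \<and> \<eta> < \<delta> \<and> norm (G_vec L h \<theta> x y) \<le> B \<longrightarrow>
        norm (step_error L h \<eta> xo x y \<theta> \<theta>') \<le> C * M\<^sup>2 * B\<^sup>2 * \<eta>\<^sup>2" for B
  proof -
    \<comment> \<open>Chosen so that a step of length at most \<open>\<eta> * (M * B)\<close> stays
      in the ball of radius \<open>r\<close> where the Taylor bound holds. The absolute value and
      the added 1 keep the denominator positive for every \<open>B\<close>.\<close>
    define \<delta> where "\<delta> = r / (\<bar>M * B\<bar> + 1)"
    have "0 < \<delta>" using \<open>0 < r\<close> by (simp add: \<delta>_def add_nonneg_pos)
    moreover have "norm (step_error L h \<eta> xo x y \<theta> \<theta>') \<le> C * M\<^sup>2 * B\<^sup>2 * \<eta>\<^sup>2"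
      if S: "(x, y) \<in> S" and \<eta>: "0 < \<eta>" "\<eta> < \<delta>" and step: "sgd_step L h \<eta> x y \<theta> \<theta>'"
        and B: "norm (G_vec L h \<theta> x y) \<le> B" for x y \<eta> \<theta>'
    proof -
      \<comment> \<open>Together with the Jacobian bound this gives \<open>0 \<le> M\<close>, which
        multiplying the two bounds requires.\<close>
      have "0 \<le> op_norm (logit_jacobian h \<theta> x)"
        unfolding op_norm_def by (intro onorm_pos_le matrix_vector_mul_bounded_linear)
      then have "op_norm (logit_jacobian h \<theta> x) * norm (G_vec L h \<theta> x y) \<le> M * B"
        using jac_le[OF S] B by (intro mult_mono) auto
      then have le: "norm (\<theta>' - \<theta>) \<le> \<eta> * (M * B)"
        using step_le[OF S S step \<eta>(1)] \<eta>(1) by (meson mult_left_mono less_imp_le order_trans)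
      \<comment> \<open>This chain only places \<theta>' inside the ball; the fact \<open>le\<close>
        is used again below, squared, for the final constant.\<close>
      also have "\<dots> \<le> \<eta> * \<bar>M * B\<bar>" using \<eta>(1) by (intro mult_left_mono) auto
      also have "\<dots> < \<eta> * (\<bar>M * B\<bar> + 1)" using \<eta>(1) by (intro mult_strict_left_mono) auto
      also have "\<dots> \<le> r" using \<eta>(2) by (simp add: \<delta>_def pos_less_divide_eq add_nonneg_pos)
      finally have "norm (step_error L h \<eta> xo x y \<theta> \<theta>') \<le> C * (norm (\<theta>' - \<theta>))\<^sup>2"
        by (rule err[OF S step])
      also have "\<dots> \<le> C * (\<eta> * (M * B))\<^sup>2"
        using le \<open>0 < C\<close> by (intro mult_left_mono power_mono) auto
      finally show ?thesis by (simp add: power_mult_distrib mult_ac)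
    qed
    ultimately show ?thesis by blast
  qed
  have near: "\<exists>r > 0. \<forall>(x, y) \<in> S. \<forall>\<eta> > 0. \<forall>\<theta>'.
      sgd_step L h \<eta> x y \<theta> \<theta>' \<and> norm (\<theta>' - \<theta>) < r \<longrightarrow>
        norm (step_error L h \<eta> xo x y \<theta> \<theta>') \<le> C * (norm (\<theta>' - \<theta>))\<^sup>2"
    using \<open>0 < r\<close> err by blast
  show ?thesis
    by (rule conjI[OF A_mat_eq], intro conjI allI G_vec_cross_entropy,
        rule exI[of _ C], intro conjI near)
      (use \<open>0 < C\<close> step_sq small in auto)
qed

end
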